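(* Let $R=\mathbb F_{q_1}\times\cdots\times\mathbb F_{q_t}$ be a product of $t\ge 3$ finite fields of orders $q_1,\dots,q_t$. For nonempty proper $A\subsetneq[t]$, write $\mathrm{val}(A)=\prod_{i\in A}(q_i-1)$ if $|A|\le t-2$ and $\mathrm{val}(A)=1$ if $|A|=t-1$. Then $$\omega(\mathcal D(R))\ \le\ \Bigl[\max_{i}(q_i-1)+(t-1)\Bigr]+\sum_{\substack{\{A,[t]\setminus A\}\\ 2\le|A|\le t-2}}\max\bigl(\mathrm{val}(A),\ \mathrm{val}([t]\setminus A)\bigr),$$ where the sum is over unordered complementary pairs $\{A,[t]\setminus A\}$ of subsets of $[t]$ with $2\le|A|\le t-2$.
   Context: $[t]=\{1,\dots,t\}$. $Z(R)$ is the set of zero-divisors of $R$ and $Z(R)^*=Z(R)\setminus\{0\}$. $\Gamma(R)$ is the simple graph with vertex set $Z(R)^*$, with distinct $x,y$ adjacent iff $xy=0$. $W\Gamma(R)$ is the simple graph with vertex set $Z(R)^*$, with distinct $x,y$ adjacent iff there exist nonzero $r\in\operatorname{Ann}(x)$ and nonzero $s\in\operatorname{Ann}(y)$ with $rs=0$. The weak zero-divisor difference graph $\mathcal D(R)$ is the graph on $Z(R)^*$ with edge set $E(W\Gamma(R))\setminus E(\Gamma(R))$, with resulting isolated vertices deleted. $\omega(G)$ is the clique number of $G$. Empty sums are $0$. *)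

theory Defs
  imports "HOL-Algebra.Algebra" "HOL-Library.Ramsey" "HOL-Library.Extended_Nat"
begin

(* Simple graphs: edges are two-element sets of vertices, the convention of
   the predicate clique of HOL-Library.Ramsey. *)
record 'v ugraph =
  verts :: "'v set"
  edges :: "'v set set"

(* Valued in enat, so that graphs with arbitrarily large cliques get the value infinity. *)
definition clique_number :: "'v ugraph \<Rightarrow> enat" where
  "clique_number G =
     (SUP K \<in> {K. K \<subseteq> verts G \<and> finite K \<and> clique K (edges G)}. enat (card K))"

(* All rings below are meant to be commutative, so one-sided conditions suffice.
   Zero counts as a zero-divisor (of a nonzero ring). *)
definition zero_divisors :: "('a, 'b) ring_scheme \<Rightarrow> 'a set" where
  "zero_divisors R =
     {x \<in> carrier R. \<exists>y \<in> carrier R. y \<noteq> \<zero>\<^bsub>R\<^esub> \<and> x \<otimes>\<^bsub>R\<^esub> y = \<zero>\<^bsub>R\<^esub>}"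

definition nonzero_zero_divisors :: "('a, 'b) ring_scheme \<Rightarrow> 'a set" where
  "nonzero_zero_divisors R = zero_divisors R - {\<zero>\<^bsub>R\<^esub>}"

definition annihilator :: "('a, 'b) ring_scheme \<Rightarrow> 'a \<Rightarrow> 'a set" where
  "annihilator R x = {r \<in> carrier R. r \<otimes>\<^bsub>R\<^esub> x = \<zero>\<^bsub>R\<^esub>}"

definition zero_divisor_graph :: "('a, 'b) ring_scheme \<Rightarrow> 'a ugraph" where
  "zero_divisor_graph R =
     \<lparr>verts = nonzero_zero_divisors R,
      edges = {{x, y} | x y. x \<in> nonzero_zero_divisors R \<and> y \<in> nonzero_zero_divisors R
                 \<and> x \<noteq> y \<and> x \<otimes>\<^bsub>R\<^esub> y = \<zero>\<^bsub>R\<^esub>}\<rparr>"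

definition weak_zero_divisor_graph :: "('a, 'b) ring_scheme \<Rightarrow> 'a ugraph" where
  "weak_zero_divisor_graph R =
     \<lparr>verts = nonzero_zero_divisors R,
      edges = {{x, y} | x y. x \<in> nonzero_zero_divisors R \<and> y \<in> nonzero_zero_divisors R
                 \<and> x \<noteq> y
                 \<and> (\<exists>r \<in> annihilator R x - {\<zero>\<^bsub>R\<^esub>}. \<exists>s \<in> annihilator R y - {\<zero>\<^bsub>R\<^esub>}.
                      r \<otimes>\<^bsub>R\<^esub> s = \<zero>\<^bsub>R\<^esub>)}\<rparr>"

definition delete_isolated :: "'v ugraph \<Rightarrow> 'v ugraph" where
  "delete_isolated G = \<lparr>verts = {v \<in> verts G. \<exists>e \<in> edges G. v \<in> e}, edges = edges G\<rparr>"

definition weak_zero_divisor_difference_graph :: "('a, 'b) ring_scheme \<Rightarrow> 'a ugraph" where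
  "weak_zero_divisor_difference_graph R =
     delete_isolated
       \<lparr>verts = nonzero_zero_divisors R,
        edges = edges (weak_zero_divisor_graph R) - edges (zero_divisor_graph R)\<rparr>"

(* Intended for nonempty proper subsets A of {1..t}, so that the second case is card A = t - 1. *)
definition supp_val :: "nat \<Rightarrow> (nat \<Rightarrow> nat) \<Rightarrow> nat set \<Rightarrow> nat" where
  "supp_val t q A = (if card A \<le> t - 2 then (\<Prod>i\<in>A. (q i - 1)) else 1)"

definition middle_pairs :: "nat \<Rightarrow> nat set set set" where
  "middle_pairs t =
     {{A, {1..t} - A} | A. A \<subseteq> {1..t} \<and> 2 \<le> card A \<and> card A \<le> t - 2}"

end

(* A vertex of the difference graph is recorded by its support A, a nonempty proper subset of
   {1..t}. Products vanish exactly when supports are disjoint, so adjacent vertices have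
   intersecting supports; and two distinct vertices with the same support of size t - 1 are not
   adjacent in the weak graph. Hence a clique uses at most one member of every complementary
   pair {A, {1..t} - A}, and at most supp_val t q A vertices with support A. Since singletons are
   pairwise disjoint, at most one of the t pairs with a singleton contributes more than one
   vertex. *)

theory Submission
  imports Defs
begin

section \<open>Clique-like families of supports\<close>

text \<open>Only intersections of supports and fibre sizes enter the count, so no ring occurs here.
  The pairs containing a singleton, together with \<open>middle_pairs t\<close>, cover every
  nonempty proper subset of \<open>{1..t}\<close>; the bound adds up the contributions over this
  cover.\<close>

lemma card_intersecting_family_le:
  fixes t :: nat and q :: "nat \<Rightarrow> nat" and S :: "'x \<Rightarrow> nat set"
  assumes t: "t \<ge> 3" and q: "\<And>i. i \<in> {1..t} \<Longrightarrow> q i \<ge> 2" and K: "finite K"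
    and S: "\<And>x. x \<in> K \<Longrightarrow> S x \<subset> {1..t}"
    and meet: "\<And>x y. x \<in> K \<Longrightarrow> y \<in> K \<Longrightarrow> S x \<inter> S y \<noteq> {}"
    and fibre: "\<And>A. A \<subset> {1..t} \<Longrightarrow> card {x \<in> K. S x = A} \<le> supp_val t q A"
  shows "card K \<le> ((MAX i\<in>{1..t}. (q i - 1)) + (t - 1))
                + (\<Sum>P\<in>middle_pairs t. MAX A\<in>P. supp_val t q A)"
proof -
  define m where "m = (MAX i\<in>{1..t}. (q i - 1))"
  define N where "N P = {x \<in> K. S x \<in> P}" for P
  \<comment> \<open>These are the outer complementary pairs, with sizes 1 and t - 1, which
    \<open>middle_pairs t\<close> leaves out.\<close>
  define E where "E i = {{i}, {1..t} - {i}}" for i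
  have finN: "finite (N P)" for P using K by (simp add: N_def)
  \<comment> \<open>A set and its complement are disjoint, so \<open>meet\<close> forbids both to
    occur as supports.\<close>
  have one_side: "card (N {A, {1..t} - A}) = card {x \<in> K. S x = A}
      \<or> card (N {A, {1..t} - A}) = card {x \<in> K. S x = {1..t} - A}" for A
  proof -
    have "{x \<in> K. S x = A} = {} \<or> {x \<in> K. S x = {1..t} - A} = {}"
      using meet by fastforce
    then have "N {A, {1..t} - A} = {x \<in> K. S x = A}
        \<or> N {A, {1..t} - A} = {x \<in> K. S x = {1..t} - A}"
      unfolding N_def by blast
    then show ?thesis by auto
  qed
  have fin_mid: "finite (middle_pairs t)"
  proof (rule finite_subset)
    show "middle_pairs t \<subseteq> (\<lambda>A. {A, {1..t} - A}) ` Pow {1..t}"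
      by (auto simp: middle_pairs_def)
  qed simp
  have mid: "card (N P) \<le> (MAX A\<in>P. supp_val t q A)" if P: "P \<in> middle_pairs t" for P
  proof -
    obtain A where A: "P = {A, {1..t} - A}" "A \<subseteq> {1..t}" "2 \<le> card A" "card A \<le> t - 2"
      using P by (clarsimp simp: middle_pairs_def)
    have "A \<noteq> {1..t}" "A \<noteq> {}" using A(3,4) t by auto
    then have "A \<subset> {1..t}" "{1..t} - A \<subset> {1..t}"
      using A(2) by blast+
    from this[THEN fibre]
    have "card (N P) \<le> supp_val t q A \<or> card (N P) \<le> supp_val t q ({1..t} - A)"
      using one_side[of A] unfolding A(1) by presburger
    then show ?thesis by (simp add: A(1) le_max_iff_disj)
  qed
  \<comment> \<open>Only the complement of \<open>{i}\<close> can then contribute, and its size t -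
    1 puts \<open>supp_val\<close> in its second case.\<close>
  have coatom: "card (N (E i)) \<le> 1" if "i \<in> {1..t}" "\<nexists>x. x \<in> K \<and> S x = {i}" for i
  proof -
    have "N (E i) = {x \<in> K. S x = {1..t} - {i}}"
      using that(2) unfolding N_def E_def by blast
    moreover have "{1..t} - {i} \<subset> {1..t}" using that(1) by blast
    ultimately have "card (N (E i)) \<le> supp_val t q ({1..t} - {i})"
      using fibre by presburger
    also have "\<dots> = 1"
      using that(1) t by (auto simp: supp_val_def card_Diff_singleton_if)
    finally show ?thesis .
  qed
  have le_m: "q i - 1 \<le> m" if "i \<in> {1..t}" for i
    unfolding m_def using that by (intro Max_ge) auto
  \<comment> \<open>The cases are whether a singleton occurs as a support. If \<open>{j}\<close>
    does, it is disjoint from every other singleton, so \<open>coatom\<close> applies to each pair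
    other than \<open>E j\<close>.\<close>
  have outer: "(\<Sum>i\<in>{1..t}. card (N (E i))) \<le> m + (t - 1)"
  proof (cases "\<exists>j x. x \<in> K \<and> S x = {j}")
    case True
    then obtain j x where x: "x \<in> K" "S x = {j}" by blast
    then have j: "j \<in> {1..t}" using S by blast
    have "N (E j) = {x \<in> K. S x = {j}}"
      using meet[OF x(1)] x(2) unfolding N_def E_def by fastforce
    moreover have "{j} \<subset> {1..t}" using S x by metis
    ultimately have "card (N (E j)) \<le> supp_val t q {j}"
      using fibre by simp
    also have "\<dots> = q j - 1"
    proof -
      \<comment> \<open>Here t \<ge> 3 is what places singletons in the product case of
        \<open>supp_val\<close>.\<close>
      have "card {j} \<le> t - 2" using t by simp
      then show ?thesis unfolding supp_val_def by simp
    qed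
    also have "\<dots> \<le> m" by (rule le_m[OF j])
    finally have Ej: "card (N (E j)) \<le> m" .
    have "card (N (E i)) \<le> 1" if "i \<in> {1..t} - {j}" for i
    proof (rule coatom)
      show "\<nexists>y. y \<in> K \<and> S y = {i}"
        using meet[OF x(1)] x(2) that by fastforce
    qed (use that in auto)
    then have "(\<Sum>i\<in>{1..t} - {j}. card (N (E i))) \<le> (\<Sum>i\<in>{1..t} - {j}. 1)"
      by (intro sum_mono)
    also have "\<dots> = t - 1"
      using j by (simp add: card_Diff_singleton)
    finally have "(\<Sum>i\<in>{1..t} - {j}. card (N (E i))) \<le> t - 1" .
    then show ?thesis
      unfolding sum.remove[OF finite_atLeastAtMost j] by (rule add_mono[OF Ej])
  next
    case False
    then have "(\<Sum>i\<in>{1..t}. card (N (E i))) \<le> (\<Sum>i\<in>{1..t}. 1)"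
      by (intro sum_mono coatom) auto
    \<comment> \<open>Without singleton supports the outer pairs give at most t = 1 + (t - 1), and
      the first 1 is absorbed by \<open>m\<close> because every \<open>q i\<close> is at least
      2.\<close>
    moreover have "1 \<le> m"
      using le_m[of 1] q[of 1] t by simp
    ultimately show ?thesis using t by simp
  qed
  have "K \<subseteq> (\<Union>i\<in>{1..t}. N (E i)) \<union> (\<Union>P\<in>middle_pairs t. N P)"
  proof
    fix x assume x: "x \<in> K"
    have fin: "finite (S x)" using S[OF x] by (auto intro: finite_subset)
    \<comment> \<open>\<open>meet\<close> includes the diagonal case, which excludes empty
      supports.\<close>
    have pos: "card (S x) \<noteq> 0" using meet[OF x x] fin by auto
    have lt: "card (S x) < t" using psubset_card_mono[OF _ S[OF x]] by simp
    consider "card (S x) = 1" | "card (S x) = t - 1" | "2 \<le> card (S x)" "card (S x) \<le> t - 2"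
      using pos lt by linarith
    then show "x \<in> (\<Union>i\<in>{1..t}. N (E i)) \<union> (\<Union>P\<in>middle_pairs t. N P)"
    proof cases
      case 1
      then obtain i where "S x = {i}" by (auto simp: card_1_singleton_iff)
      then have "x \<in> N (E i)" "i \<in> {1..t}" using S[OF x] x by (auto simp: N_def E_def)
      then show ?thesis by blast
    next
      case 2
      then have "card ({1..t} - S x) = 1"
        using S[OF x] fin t by (subst card_Diff_subset) auto
      then obtain i where i: "{1..t} - S x = {i}" by (auto simp: card_1_singleton_iff)
      then have "S x = {1..t} - {i}" "i \<in> {1..t}" using S[OF x] by blast+
      then have "x \<in> N (E i)" "i \<in> {1..t}" using x by (simp_all add: N_def E_def)
      then show ?thesis by blast
    next
      case 3
      then have "{S x, {1..t} - S x} \<in> middle_pairs t"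
        using S[OF x] unfolding middle_pairs_def by blast
      moreover have "x \<in> N {S x, {1..t} - S x}" using x by (simp add: N_def)
      ultimately show ?thesis by blast
    qed
  qed
  then have "card K \<le> card ((\<Union>i\<in>{1..t}. N (E i)) \<union> (\<Union>P\<in>middle_pairs t. N P))"
    using finN fin_mid by (intro card_mono) auto
  also have "\<dots> \<le> card (\<Union>i\<in>{1..t}. N (E i)) + card (\<Union>P\<in>middle_pairs t. N P)"
    by (rule card_Un_le)
  also have "\<dots> \<le> (\<Sum>i\<in>{1..t}. card (N (E i))) + (\<Sum>P\<in>middle_pairs t. card (N P))"
    using fin_mid by (intro add_mono card_UN_le) auto
  also have "\<dots> \<le> (m + (t - 1)) + (\<Sum>P\<in>middle_pairs t. MAX A\<in>P. supp_val t q A)"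
    using mid by (intro add_mono[OF outer] sum_mono)
  finally show ?thesis unfolding m_def .
qed

section \<open>Componentwise arithmetic in a finite product of rings\<close>

text \<open>The map (a, as) to a # as is a ring isomorphism from the binary product, where
  multiplication is componentwise by definition; its homomorphism law carries this over to
  lists.\<close>

lemma RDirProd_list_mult_Cons:
  assumes "x \<in> carrier R" "y \<in> carrier R"
    and "xs \<in> carrier (RDirProd_list Rs)" "ys \<in> carrier (RDirProd_list Rs)"
  shows "(x # xs) \<otimes>\<^bsub>RDirProd_list (R # Rs)\<^esub> (y # ys)
           = (x \<otimes>\<^bsub>R\<^esub> y) # (xs \<otimes>\<^bsub>RDirProd_list Rs\<^esub> ys)"
proof -
  have "(\<lambda>(a, as). a # as) \<in> ring_hom (RDirProd R (RDirProd_list Rs)) (RDirProd_list (R # Rs))"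
    using RDirProd_list_iso1 by (auto simp: ring_iso_def)
  from ring_hom_mult[OF this, of "(x, xs)" "(y, ys)"] show ?thesis
    using assms by (simp add: RDirProd_carrier RDirProd_def DirProd_def monoid.defs)
qed

lemma RDirProd_list_mult_nth:
  assumes "xs \<in> carrier (RDirProd_list Rs)" "ys \<in> carrier (RDirProd_list Rs)"
    and "i < length Rs"
  shows "(xs \<otimes>\<^bsub>RDirProd_list Rs\<^esub> ys) ! i = xs ! i \<otimes>\<^bsub>Rs ! i\<^esub> ys ! i"
  using assms
proof (induction Rs arbitrary: xs ys i)
  case (Cons R Rs)
  from Cons.prems obtain x xs' y ys' where
    "xs = x # xs'" "x \<in> carrier R" "xs' \<in> carrier (RDirProd_list Rs)"
    "ys = y # ys'" "y \<in> carrier R" "ys' \<in> carrier (RDirProd_list Rs)"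
    unfolding RDirProd_list_carrier by auto
  with Cons show ?case
    by (cases i) (auto simp: RDirProd_list_mult_Cons)
qed simp

lemma RDirProd_list_zero_nth:
  "i < length Rs \<Longrightarrow> \<zero>\<^bsub>RDirProd_list Rs\<^esub> ! i = \<zero>\<^bsub>Rs ! i\<^esub>"
proof (induction Rs arbitrary: i)
  case (Cons R Rs)
  then show ?case by (cases i) (auto simp: RDirProd_list_zero')
qed simp

section \<open>Supports of elements of a product of finite fields\<close>

locale finite_field_product =
  fixes t :: nat and F :: "nat \<Rightarrow> ('a, 'b) ring_scheme"
  assumes is_field: "\<And>i. i \<in> {1..t} \<Longrightarrow> field (F i)"
    and finite_factor: "\<And>i. i \<in> {1..t} \<Longrightarrow> finite (carrier (F i))"
begin

definition R :: "'a list ring" where "R = RDirProd_list (map F [1..<Suc t])"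

(* The factors are numbered from 1, list positions from 0. *)
definition supp :: "'a list \<Rightarrow> nat set" where
  "supp x = {i \<in> {1..t}. x ! (i - 1) \<noteq> \<zero>\<^bsub>F i\<^esub>}"

lemma ring_R: "ring R"
  unfolding R_def
proof (rule RDirProd_list_is_ring)
  fix i assume "i < length (map F [1..<Suc t])"
  then show "ring (map F [1..<Suc t] ! i)"
    using is_field[of "Suc i"] by (simp del: upt_Suc add: field_def domain_def cring_def)
qed

lemma carrier_R_length: "x \<in> carrier R \<Longrightarrow> length x = t"
  unfolding R_def by (drule RDirProd_list_carrier_mem(1)) simp

lemma carrier_R_nth: "x \<in> carrier R \<Longrightarrow> i \<in> {1..t} \<Longrightarrow> x ! (i - 1) \<in> carrier (F i)"
  unfolding R_def using RDirProd_list_carrier_mem(2)[of x "map F [1..<Suc t]" "i - 1"]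
  by (auto simp del: upt_Suc)

lemma carrier_R_eqI:
  assumes "x \<in> carrier R" "y \<in> carrier R"
    and "\<And>i. i \<in> {1..t} \<Longrightarrow> x ! (i - 1) = y ! (i - 1)"
  shows "x = y"
proof (rule nth_equalityI)
  fix i assume "i < length x"
  then show "x ! i = y ! i"
    using assms(3)[of "Suc i"] carrier_R_length[OF assms(1)] by simp
qed (use assms carrier_R_length in simp)

lemma zero_R_nth: "i \<in> {1..t} \<Longrightarrow> \<zero>\<^bsub>R\<^esub> ! (i - 1) = \<zero>\<^bsub>F i\<^esub>"
  unfolding R_def using RDirProd_list_zero_nth[of "i - 1" "map F [1..<Suc t]"]
  by (auto simp del: upt_Suc)

lemma mult_R_nth:
  assumes "x \<in> carrier R" "y \<in> carrier R" "i \<in> {1..t}"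
  shows "(x \<otimes>\<^bsub>R\<^esub> y) ! (i - 1) = x ! (i - 1) \<otimes>\<^bsub>F i\<^esub> y ! (i - 1)"
  using assms RDirProd_list_mult_nth[of x "map F [1..<Suc t]" y "i - 1"]
  unfolding R_def by (auto simp del: upt_Suc)

lemma supp_subset: "supp x \<subseteq> {1..t}"
  by (auto simp: supp_def)

lemma supp_eq_empty_iff:
  assumes "x \<in> carrier R"
  shows "supp x = {} \<longleftrightarrow> x = \<zero>\<^bsub>R\<^esub>"
proof
  assume "supp x = {}"
  then show "x = \<zero>\<^bsub>R\<^esub>"
    using assms ring.ring_simprules(2)[OF ring_R]
    by (intro carrier_R_eqI) (auto simp: supp_def zero_R_nth simp del: One_nat_def)
next
  assume "x = \<zero>\<^bsub>R\<^esub>"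
  then show "supp x = {}" by (auto simp: supp_def zero_R_nth simp del: One_nat_def)
qed

text \<open>A field is an integral domain, so a coordinate of the product is nonzero exactly when
  both factors are nonzero there.\<close>

lemma supp_mult:
  assumes "x \<in> carrier R" "y \<in> carrier R"
  shows "supp (x \<otimes>\<^bsub>R\<^esub> y) = supp x \<inter> supp y"
proof -
  have "(x \<otimes>\<^bsub>R\<^esub> y) ! (i - 1) = \<zero>\<^bsub>F i\<^esub> \<longleftrightarrow> x ! (i - 1) = \<zero>\<^bsub>F i\<^esub> \<or> y ! (i - 1) = \<zero>\<^bsub>F i\<^esub>"
    if i: "i \<in> {1..t}" for i
  proof -
    interpret field "F i" using is_field[OF i] .
    show ?thesis
      unfolding mult_R_nth[OF assms i] using carrier_R_nth[OF _ i] assms by (intro integral_iff)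
  qed
  then show ?thesis unfolding supp_def by blast
qed

lemma mult_eq_zero_iff:
  assumes "x \<in> carrier R" "y \<in> carrier R"
  shows "x \<otimes>\<^bsub>R\<^esub> y = \<zero>\<^bsub>R\<^esub> \<longleftrightarrow> supp x \<inter> supp y = {}"
  using supp_eq_empty_iff[of "x \<otimes>\<^bsub>R\<^esub> y"] supp_mult[OF assms] assms
    ring.ring_simprules(5)[OF ring_R] by simp

text \<open>Restriction to the coordinates in \<open>A\<close> is injective on elements with support
  \<open>A\<close>, as all other coordinates are zero, and its values are families of nonzero field
  elements.\<close>

lemma card_supp_fibre_le:
  assumes "A \<subseteq> {1..t}"
  shows "finite {x \<in> carrier R. supp x = A}"
    and "card {x \<in> carrier R. supp x = A} \<le> (\<Prod>i\<in>A. order (F i) - 1)"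
proof -
  let ?X = "{x \<in> carrier R. supp x = A}"
  let ?f = "\<lambda>x. restrict (\<lambda>i. x ! (i - 1)) A"
  let ?Y = "PiE A (\<lambda>i. carrier (F i) - {\<zero>\<^bsub>F i\<^esub>})"
  have finA: "finite A" using assms finite_subset by blast
  have finY: "finite ?Y"
    using finA assms finite_factor by (intro finite_PiE) auto
  have into: "?f ` ?X \<subseteq> ?Y"
    using carrier_R_nth by (auto simp: supp_def simp del: One_nat_def)
  have inj: "inj_on ?f ?X"
  proof (rule inj_onI)
    fix x y assume x: "x \<in> ?X" and y: "y \<in> ?X" and eq: "?f x = ?f y"
    show "x = y"
    proof (rule carrier_R_eqI)
      fix i assume i: "i \<in> {1..t}"
      show "x ! (i - 1) = y ! (i - 1)"
      proof (cases "i \<in> A")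
        case True
        then show ?thesis using fun_cong[OF eq, of i] by simp
      next
        case False
        then have "i \<notin> supp x" "i \<notin> supp y" using x y by auto
        then show ?thesis using i by (simp add: supp_def)
      qed
    qed (use x y in auto)
  qed
  show "finite ?X" using inj_on_finite[OF inj into finY] .
  have "card ?X \<le> card ?Y" using card_inj_on_le[OF inj into finY] .
  also have "\<dots> = (\<Prod>i\<in>A. card (carrier (F i) - {\<zero>\<^bsub>F i\<^esub>}))"
    using finA by (rule card_PiE)
  also have "\<dots> = (\<Prod>i\<in>A. order (F i) - 1)"
  proof (rule prod.cong)
    fix i assume "i \<in> A"
    then interpret field "F i" using is_field assms by blast
    show "card (carrier (F i) - {\<zero>\<^bsub>F i\<^esub>}) = order (F i) - 1"
      by (simp add: card_Diff_singleton order_def)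
  qed simp
  finally show "card ?X \<le> (\<Prod>i\<in>A. order (F i) - 1)" .
qed

lemma order_ge_2: "i \<in> {1..t} \<Longrightarrow> 2 \<le> order (F i)"
proof -
  assume i: "i \<in> {1..t}"
  interpret field "F i" using is_field[OF i] .
  have "card {\<zero>\<^bsub>F i\<^esub>, \<one>\<^bsub>F i\<^esub>} \<le> card (carrier (F i))"
    using finite_factor[OF i] by (intro card_mono) auto
  then show ?thesis by (simp add: order_def)
qed

section \<open>Vertices and edges of the difference graph in terms of supports\<close>

lemma nonzero_zero_divisorsD:
  assumes "x \<in> nonzero_zero_divisors R"
  shows "x \<in> carrier R" "supp x \<noteq> {}" "supp x \<subset> {1..t}"
proof -
  show x: "x \<in> carrier R"
    using assms by (auto simp: nonzero_zero_divisors_def zero_divisors_def)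
  show "supp x \<noteq> {}"
    using assms supp_eq_empty_iff[OF x] by (simp add: nonzero_zero_divisors_def)
  \<comment> \<open>The support of the nonzero witness \<open>y\<close> provides an index missing
    from \<open>supp x\<close>, which makes the inclusion strict.\<close>
  obtain y where y: "y \<in> carrier R" "y \<noteq> \<zero>\<^bsub>R\<^esub>" "x \<otimes>\<^bsub>R\<^esub> y = \<zero>\<^bsub>R\<^esub>"
    using assms by (auto simp: nonzero_zero_divisors_def zero_divisors_def)
  then have "supp x \<inter> supp y = {}" "supp y \<noteq> {}"
    using mult_eq_zero_iff[OF x] supp_eq_empty_iff by auto
  then show "supp x \<subset> {1..t}" using supp_subset[of x] supp_subset[of y] by blast
qed

text \<open>A non-edge of the zero-divisor graph has a nonzero product, hence meeting supports. For
  a common support, the nonzero annihilators \<open>r\<close> and \<open>s\<close> live outside it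
  and have disjoint supports themselves, so at least two indices are missing.\<close>

lemma difference_edgeD:
  assumes "{x, y} \<in> edges (weak_zero_divisor_graph R) - edges (zero_divisor_graph R)"
  shows "supp x \<inter> supp y \<noteq> {}" and "supp x = supp y \<Longrightarrow> card (supp x) \<le> t - 2"
proof -
  \<comment> \<open>Edges are unordered, so \<open>u\<close>, \<open>v\<close> agree with
    \<open>x\<close>, \<open>y\<close> only up to a swap; both conclusions are symmetric.\<close>
  obtain u v r s where e: "{x, y} = {u, v}"
    and uv: "u \<in> nonzero_zero_divisors R" "v \<in> nonzero_zero_divisors R" "u \<noteq> v"
    and r: "r \<in> annihilator R u - {\<zero>\<^bsub>R\<^esub>}" and s: "s \<in> annihilator R v - {\<zero>\<^bsub>R\<^esub>}"
    and rs: "r \<otimes>\<^bsub>R\<^esub> s = \<zero>\<^bsub>R\<^esub>"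
    using assms by (auto simp: weak_zero_divisor_graph_def)
  have "{u, v} \<notin> edges (zero_divisor_graph R)" using assms e by simp
  then have "u \<otimes>\<^bsub>R\<^esub> v \<noteq> \<zero>\<^bsub>R\<^esub>"
    using uv by (auto simp: zero_divisor_graph_def)
  note car = nonzero_zero_divisorsD(1)[OF uv(1)] nonzero_zero_divisorsD(1)[OF uv(2)]
  have "supp u \<inter> supp v \<noteq> {}"
    using \<open>u \<otimes>\<^bsub>R\<^esub> v \<noteq> \<zero>\<^bsub>R\<^esub>\<close> mult_eq_zero_iff[OF car] by simp
  then show "supp x \<inter> supp y \<noteq> {}" using e by (auto simp: doubleton_eq_iff)
  assume "supp x = supp y"
  then have eq: "supp u = supp x" "supp v = supp x" using e by (auto simp: doubleton_eq_iff)
  have "supp r \<inter> supp u = {}" "supp s \<inter> supp v = {}" "supp r \<inter> supp s = {}"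
    "supp r \<noteq> {}" "supp s \<noteq> {}"
    using r s rs car by (auto simp: annihilator_def mult_eq_zero_iff supp_eq_empty_iff)
  then obtain i j where ij: "i \<in> supp r" "j \<in> supp s" "i \<noteq> j" "i \<notin> supp x" "j \<notin> supp x"
    using eq by blast
  have sub: "supp x \<subseteq> {1..t} - {i, j}" using supp_subset[of x] ij by blast
  have "{i, j} \<subseteq> {1..t}" using ij supp_subset[of r] supp_subset[of s] by blast
  then have "card ({1..t} - {i, j}) = t - 2" using ij(3) by (simp add: card_Diff_subset)
  then show "card (supp x) \<le> t - 2" using card_mono[OF _ sub] by simp
qed

end

section \<open>The clique number of the difference graph\<close>

theorem proposition6p8:
  fixes t :: nat
    and F :: "nat \<Rightarrow> ('a, 'b) ring_scheme"
    and q :: "nat \<Rightarrow> nat"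
  assumes "t \<ge> 3"
    and "\<And>i. i \<in> {1..t} \<Longrightarrow> field (F i)"
    and "\<And>i. i \<in> {1..t} \<Longrightarrow> finite (carrier (F i))"
    and "\<And>i. i \<in> {1..t} \<Longrightarrow> order (F i) = q i"
  shows "clique_number (weak_zero_divisor_difference_graph (RDirProd_list (map F [1..<Suc t])))
           \<le> enat (((MAX i\<in>{1..t}. (q i - 1)) + (t - 1))
                + (\<Sum>P\<in>middle_pairs t. MAX A\<in>P. supp_val t q A))"
proof -
  interpret finite_field_product t F
    by (rule finite_field_product.intro) (fact assms(2), fact assms(3))
  let ?E = "edges (weak_zero_divisor_graph R) - edges (zero_divisor_graph R)"
  have bound: "card K \<le> ((MAX i\<in>{1..t}. (q i - 1)) + (t - 1))
                + (\<Sum>P\<in>middle_pairs t. MAX A\<in>P. supp_val t q A)"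
    if K: "K \<subseteq> nonzero_zero_divisors R" "finite K" "clique K ?E" for K
  proof (rule card_intersecting_family_le[where S = supp])
    show "t \<ge> 3" "finite K" by fact+
    show "q i \<ge> 2" if "i \<in> {1..t}" for i
      using order_ge_2[OF that] assms(4)[OF that] by simp
    show "supp x \<subset> {1..t}" if "x \<in> K" for x
      using that K(1) nonzero_zero_divisorsD(3) by blast
    show "supp x \<inter> supp y \<noteq> {}" if xy: "x \<in> K" "y \<in> K" for x y
    \<comment> \<open>The clique condition speaks of distinct vertices only; on the diagonal the
      claim is that a vertex has nonempty support.\<close>
    proof (cases "x = y")
      case True
      then show ?thesis using xy K(1) nonzero_zero_divisorsD(2) by blast
    next
      case False
      then have "{x, y} \<in> ?E" using xy K(3) unfolding clique_def by blast
      then show ?thesis by (rule difference_edgeD(1))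
    qed
    show "card {x \<in> K. supp x = A} \<le> supp_val t q A" if A: "A \<subset> {1..t}" for A
    proof (cases "card A \<le> t - 2")
      case True
      have "card {x \<in> K. supp x = A} \<le> card {x \<in> carrier R. supp x = A}"
        using K(1) nonzero_zero_divisorsD(1) A
        by (intro card_mono card_supp_fibre_le(1)) auto
      also have "\<dots> \<le> (\<Prod>i\<in>A. order (F i) - 1)"
        using A by (intro card_supp_fibre_le(2)) auto
      also have "\<dots> = supp_val t q A"
        unfolding supp_val_def using True A assms(4) by (auto intro!: prod.cong)
      finally show ?thesis .
    next
      case False
      \<comment> \<open>Two distinct clique members with support \<open>A\<close> would form an edge
        and force \<open>card A\<close> \<le> t - 2, so the fibre has at most one element.\<close>
      have "x = y" if "x \<in> K" "y \<in> K" "supp x = A" "supp y = A" for x y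
      proof (rule ccontr)
        assume "x \<noteq> y"
        then have "{x, y} \<in> ?E" using that K(3) unfolding clique_def by blast
        from difference_edgeD(2)[OF this] show False using that False by simp
      qed
      then have "card {x \<in> K. supp x = A} \<le> 1"
        by (auto simp: card_le_Suc0_iff_eq K(2))
      then show ?thesis using False by (simp add: supp_val_def)
    qed
  qed
  show ?thesis
    unfolding clique_number_def R_def[symmetric]
  \<comment> \<open>Deleting isolated vertices shrinks the vertex set and keeps the edges, so every
    clique of the difference graph satisfies the assumptions of \<open>bound\<close>.\<close>
  proof (rule SUP_least, unfold enat_ord_simps, rule bound)
  qed (auto simp: weak_zero_divisor_difference_graph_def delete_isolated_def)
qed

end
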